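(* Let $L$ be a simple Lie algebra over a field $k\neq\mathbb F_2$, generated by its pure extremal elements, and assume that the extremal geometry of $L$ contains lines. Let $x,y\in E$ with $g(x,y)=1$ and let $L=L_{-2}\oplus L_{-1}\oplus L_0\oplus L_1\oplus L_2$ be the associated $5$-grading. Then both $L_{-1}$ and $L_1$ are linearly spanned by the extremal elements contained in them.
   Context: A nonzero $x\in L$ is extremal if there is $g_x\colon L\to k$ with $[x,[x,u]]=2g_x(u)x$, $[[x,u],[x,w]]=g_x([u,w])x+g_x(w)[x,u]-g_x(u)[x,w]$, $[x,[u,[x,w]]]=g_x([u,w])x-g_x(w)[x,u]-g_x(u)[x,w]$ for all $u,w\in L$; a sandwich satisfies $[x,[x,u]]=0=[x,[u,[x,w]]]$ for all $u,w$; a pure extremal element is an extremal non-sandwich; $E$ is the set of extremal elements. $g$ is the unique symmetric bilinear form with $g(x,u)=g_x(u)$ for $x\in E$ (it satisfies $g([a,b],c)=g(a,[b,c])$). Pure extremal $a,b$ with $ka\neq kb$ are collinear if $[a,b]=0$ and $\lambda a+\mu b\in E\cup\{0\}$ for all $\lambda,\mu$; the extremal geometry contains lines iff such a pair exists. The $5$-grading associated with $x,y$ ($g(x,y)=1$): $L_{-2}=kx$, $L_{-1}=[x,U]$, $L_0=\{l:[x,l]\in kx,\ [y,l]\in ky\}$, $L_1=[y,U]$, $L_2=ky$, where $U=\{u:g(u,x)=g(u,y)=g(u,[x,y])=0\}$. *)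

theory Defs
  imports Complex_Main
begin

definition lie_algebra :: "('k::field \<Rightarrow> 'v::ab_group_add \<Rightarrow> 'v) \<Rightarrow> ('v \<Rightarrow> 'v \<Rightarrow> 'v) \<Rightarrow> bool" where
  "lie_algebra sm br \<longleftrightarrow>
     vector_space sm \<and>
     (\<forall>a u v w. br (sm a u + v) w = sm a (br u w) + br v w) \<and>
     (\<forall>a u v w. br u (sm a v + w) = sm a (br u v) + br u w) \<and>
     (\<forall>u. br u u = 0) \<and>
     (\<forall>u v w. br u (br v w) + br v (br w u) + br w (br u v) = 0)"

definition lie_ideal :: "('k::field \<Rightarrow> 'v::ab_group_add \<Rightarrow> 'v) \<Rightarrow> ('v \<Rightarrow> 'v \<Rightarrow> 'v) \<Rightarrow> 'v set \<Rightarrow> bool" where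
  "lie_ideal sm br I \<longleftrightarrow> module.subspace sm I \<and> (\<forall>u v. v \<in> I \<longrightarrow> br u v \<in> I)"

definition simple_lie_algebra :: "('k::field \<Rightarrow> 'v::ab_group_add \<Rightarrow> 'v) \<Rightarrow> ('v \<Rightarrow> 'v \<Rightarrow> 'v) \<Rightarrow> bool" where
  "simple_lie_algebra sm br \<longleftrightarrow> lie_algebra sm br \<and> (\<exists>u v. br u v \<noteq> 0) \<and>
     (\<forall>I. lie_ideal sm br I \<longrightarrow> I = {0} \<or> I = UNIV)"

definition lie_subalgebra :: "('k::field \<Rightarrow> 'v::ab_group_add \<Rightarrow> 'v) \<Rightarrow> ('v \<Rightarrow> 'v \<Rightarrow> 'v) \<Rightarrow> 'v set \<Rightarrow> bool" where
  "lie_subalgebra sm br A \<longleftrightarrow> module.subspace sm A \<and> (\<forall>u\<in>A. \<forall>v\<in>A. br u v \<in> A)"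

definition lie_generated :: "('k::field \<Rightarrow> 'v::ab_group_add \<Rightarrow> 'v) \<Rightarrow> ('v \<Rightarrow> 'v \<Rightarrow> 'v) \<Rightarrow> 'v set \<Rightarrow> 'v set" where
  "lie_generated sm br S = \<Inter>{A. lie_subalgebra sm br A \<and> S \<subseteq> A}"

definition extremal_identities :: "('k::field \<Rightarrow> 'v::ab_group_add \<Rightarrow> 'v) \<Rightarrow> ('v \<Rightarrow> 'v \<Rightarrow> 'v) \<Rightarrow> 'v \<Rightarrow> ('v \<Rightarrow> 'k) \<Rightarrow> bool" where
  "extremal_identities sm br x gx \<longleftrightarrow>
     (\<forall>u. br x (br x u) = sm (2 * gx u) x) \<and>
     (\<forall>u w. br (br x u) (br x w) = sm (gx (br u w)) x + sm (gx w) (br x u) - sm (gx u) (br x w)) \<and>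
     (\<forall>u w. br x (br u (br x w)) = sm (gx (br u w)) x - sm (gx w) (br x u) - sm (gx u) (br x w))"

definition extremal :: "('k::field \<Rightarrow> 'v::ab_group_add \<Rightarrow> 'v) \<Rightarrow> ('v \<Rightarrow> 'v \<Rightarrow> 'v) \<Rightarrow> 'v \<Rightarrow> bool" where
  "extremal sm br x \<longleftrightarrow> x \<noteq> 0 \<and> (\<exists>gx. extremal_identities sm br x gx)"

definition sandwich :: "('v::ab_group_add \<Rightarrow> 'v \<Rightarrow> 'v) \<Rightarrow> 'v \<Rightarrow> bool" where
  "sandwich br x \<longleftrightarrow> (\<forall>u. br x (br x u) = 0) \<and> (\<forall>u w. br x (br u (br x w)) = 0)"

definition pure_extremal :: "('k::field \<Rightarrow> 'v::ab_group_add \<Rightarrow> 'v) \<Rightarrow> ('v \<Rightarrow> 'v \<Rightarrow> 'v) \<Rightarrow> 'v \<Rightarrow> bool" where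
  "pure_extremal sm br x \<longleftrightarrow> extremal sm br x \<and> \<not> sandwich br x"

definition extremal_form :: "('k::field \<Rightarrow> 'v::ab_group_add \<Rightarrow> 'v) \<Rightarrow> ('v \<Rightarrow> 'v \<Rightarrow> 'v) \<Rightarrow> ('v \<Rightarrow> 'v \<Rightarrow> 'k) \<Rightarrow> bool" where
  "extremal_form sm br g \<longleftrightarrow>
     (\<forall>a u v w. g (sm a u + v) w = a * g u w + g v w) \<and>
     (\<forall>u v. g u v = g v u) \<and>
     (\<forall>x. extremal sm br x \<longrightarrow> extremal_identities sm br x (g x))"

definition collinear :: "('k::field \<Rightarrow> 'v::ab_group_add \<Rightarrow> 'v) \<Rightarrow> ('v \<Rightarrow> 'v \<Rightarrow> 'v) \<Rightarrow> 'v \<Rightarrow> 'v \<Rightarrow> bool" where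
  "collinear sm br a b \<longleftrightarrow> pure_extremal sm br a \<and> pure_extremal sm br b \<and>
     range (\<lambda>c. sm c a) \<noteq> range (\<lambda>c. sm c b) \<and> br a b = 0 \<and>
     (\<forall>c d. extremal sm br (sm c a + sm d b) \<or> sm c a + sm d b = 0)"

definition has_lines :: "('k::field \<Rightarrow> 'v::ab_group_add \<Rightarrow> 'v) \<Rightarrow> ('v \<Rightarrow> 'v \<Rightarrow> 'v) \<Rightarrow> bool" where
  "has_lines sm br \<longleftrightarrow> (\<exists>a b. collinear sm br a b)"

definition grading_U :: "('v \<Rightarrow> 'v \<Rightarrow> 'v) \<Rightarrow> ('v \<Rightarrow> 'v \<Rightarrow> 'k::zero) \<Rightarrow> 'v \<Rightarrow> 'v \<Rightarrow> 'v set" where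
  "grading_U br g x y = {u. g u x = 0 \<and> g u y = 0 \<and> g u (br x y) = 0}"

definition grading_Lm1 :: "('v \<Rightarrow> 'v \<Rightarrow> 'v) \<Rightarrow> ('v \<Rightarrow> 'v \<Rightarrow> 'k::zero) \<Rightarrow> 'v \<Rightarrow> 'v \<Rightarrow> 'v set" where
  "grading_Lm1 br g x y = br x ` grading_U br g x y"

definition grading_L1 :: "('v \<Rightarrow> 'v \<Rightarrow> 'v) \<Rightarrow> ('v \<Rightarrow> 'v \<Rightarrow> 'k::zero) \<Rightarrow> 'v \<Rightarrow> 'v \<Rightarrow> 'v set" where
  "grading_L1 br g x y = br y ` grading_U br g x y"

end

theory Submission
  imports Defs
begin

text \<open>
  Each extremal e has automorphisms exp(te) of L. They make g invariant, hence
  associative and nondegenerate, and show that L is spanned by its extremal elements. If z is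
  extremal and g(x,z) = 0 then [x,z] + lx is extremal or zero. So the span W of the
  extremal elements of L_{-1} contains [x,z_1] whenever g(x,z) = 0, where z_1 is the
  component of z in L_1, and we need this for all extremal z.

  Suppose c, d are extremal in L_{-1} with [d,c] = kx, k nonzero, and put b = -[y,d],
  b' = -[y,c]. Moving z into the hyperplane orthogonal to x by exp(sc) followed by exp(tb),
  for two values of s, gives k [x,z_1] = [x,[b,[c,z_1]]] modulo W, and symmetrically
  -k [x,z_1] = [x,[b',[d,z_1]]]. On the other hand, by the Jacobi identity,
  [x,[b,[c,z_1]]] - [x,[b',[d,z_1]]] = k [x,z_1] modulo W. Together, [x,z_1] lies in W.

  Given c, such a d comes from nondegeneracy of g. If there were no extremal c in L_{-1},
  then, all extremal elements being conjugate up to scalars, any two orthogonal extremal elements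
  would commute; this is incompatible with the existence of a line, which then would contain
  a sandwich.
\<close>

locale extremal_lie =
  fixes sm :: "'k::field \<Rightarrow> 'v::ab_group_add \<Rightarrow> 'v" (infixr "*s" 75)
    and br :: "'v \<Rightarrow> 'v \<Rightarrow> 'v"
    and g :: "'v \<Rightarrow> 'v \<Rightarrow> 'k"
  assumes card_k: "card (UNIV :: 'k set) \<noteq> 2"
    and simple: "simple_lie_algebra sm br"
    and gen: "lie_generated sm br {z. pure_extremal sm br z} = UNIV"
    and form: "extremal_form sm br g"
begin

section \<open>Arithmetic of the bracket, the form and the extremal identities\<close>

lemma lie: "lie_algebra sm br"
  using simple by (simp add: simple_lie_algebra_def)

sublocale vector_space sm
  using lie by (simp add: lie_algebra_def)

abbreviation ext :: "'v \<Rightarrow> bool" where "ext \<equiv> extremal sm br"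
abbreviation pure :: "'v \<Rightarrow> bool" where "pure \<equiv> pure_extremal sm br"

lemma br_add_left [algebra_simps]: "br (u + v) w = br u w + br v w"
  using lie unfolding lie_algebra_def by (metis scale_one)

lemma br_add_right [algebra_simps]: "br u (v + w) = br u v + br u w"
  using lie unfolding lie_algebra_def by (metis scale_one)

lemma br_zero_left [simp]: "br 0 w = 0"
  using br_add_left[of 0 0 w] by simp

lemma br_zero_right [simp]: "br w 0 = 0"
  using br_add_right[of w 0 0] by simp

lemma br_scale_left [simp]: "br (a *s u) w = a *s br u w"
  using lie unfolding lie_algebra_def by (metis br_zero_left add.right_neutral)

lemma br_scale_right [simp]: "br u (a *s w) = a *s br u w"
  using lie unfolding lie_algebra_def by (metis br_zero_right add.right_neutral)

lemma br_minus_left [simp]: "br (- u) w = - br u w"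
  using br_add_left[of u "- u" w] by (simp add: eq_neg_iff_add_eq_0 add.commute)

lemma br_minus_right [simp]: "br u (- w) = - br u w"
  using br_add_right[of u w "- w"] by (simp add: eq_neg_iff_add_eq_0 add.commute)

lemma br_diff_left [algebra_simps]: "br (u - v) w = br u w - br v w"
  using br_add_left[of u "- v" w] by simp

lemma br_diff_right [algebra_simps]: "br u (v - w) = br u v - br u w"
  using br_add_right[of u v "- w"] by simp

lemma br_self [simp]: "br u u = 0"
  using lie by (simp add: lie_algebra_def)

lemma br_skew: "br u v = - br v u"
proof -
  have "br u v + br v u = br (u + v) (u + v)"
    by (simp only: br_add_left br_add_right) simp
  then show ?thesis by (simp add: eq_neg_iff_add_eq_0)
qed

lemma jacobi: "br u (br v w) = br (br u v) w + br v (br u w)"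
proof -
  have "br u (br v w) + br v (br w u) + br w (br u v) = 0"
    using lie by (simp add: lie_algebra_def)
  then show ?thesis
    using br_skew[of w u] br_skew[of w "br u v"] by (simp add: algebra_simps)
qed

lemma g_sym: "g u v = g v u"
  using form by (simp add: extremal_form_def)

lemma g_add_left [algebra_simps]: "g (u + v) w = g u w + g v w"
  using form unfolding extremal_form_def by (metis scale_one mult_1)

lemma g_zero_left [simp]: "g 0 w = 0"
  using g_add_left[of 0 0 w] by (simp only: add_0 add_cancel_right_right)

lemma g_scale_left [simp]: "g (a *s u) w = a * g u w"
  using form unfolding extremal_form_def by (metis g_zero_left add.right_neutral)

lemma g_add_right [algebra_simps]: "g w (u + v) = g w u + g w v"
  by (simp add: g_sym[of w] g_add_left)

lemma g_zero_right [simp]: "g w 0 = 0"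
  by (simp add: g_sym[of w])

lemma g_scale_right [simp]: "g w (a *s u) = a * g w u"
  by (simp add: g_sym[of w])

lemma g_minus_left [simp]: "g (- u) w = - g u w"
  using g_add_left[of u "- u" w] by (simp add: eq_neg_iff_add_eq_0 add.commute)

lemma g_minus_right [simp]: "g w (- u) = - g w u"
  by (simp add: g_sym[of w])

lemma g_diff_left [algebra_simps]: "g (u - v) w = g u w - g v w"
  using g_add_left[of u "- v" w] by simp

lemma g_diff_right [algebra_simps]: "g w (u - v) = g w u - g w v"
  by (simp add: g_sym[of w] g_diff_left)

lemma ext_identities: "ext e \<Longrightarrow> extremal_identities sm br e (g e)"
  using form by (simp add: extremal_form_def)

lemma ext_nonzero: "ext e \<Longrightarrow> e \<noteq> 0"
  by (simp add: extremal_def)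

lemma ext_br_br: "ext e \<Longrightarrow> br e (br e u) = (2 * g e u) *s e"
  using ext_identities by (simp add: extremal_identities_def)

lemma ext_premet1:
  "ext e \<Longrightarrow> br (br e u) (br e w) = g e (br u w) *s e + g e w *s br e u - g e u *s br e w"
  using ext_identities by (simp add: extremal_identities_def)

lemma ext_premet2:
  "ext e \<Longrightarrow> br e (br u (br e w)) = g e (br u w) *s e - g e w *s br e u - g e u *s br e w"
  using ext_identities by (simp add: extremal_identities_def)

lemma extI: "\<lbrakk>e \<noteq> 0; extremal_identities sm br e f\<rbrakk> \<Longrightarrow> ext e"
  by (auto simp: extremal_def)

lemma extremal_identities_scale:
  assumes "extremal_identities sm br e f"
  shows "extremal_identities sm br (a *s e) (\<lambda>u. a * f u)"
  using assms unfolding extremal_identities_def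
  by (simp add: scale_right_distrib scale_right_diff_distrib mult_ac)

lemma ext_scale: "\<lbrakk>ext e; a \<noteq> 0\<rbrakk> \<Longrightarrow> ext (a *s e)"
  using extremal_identities_scale[OF ext_identities, of e a] ext_nonzero[of e] by (auto intro: extI)

lemma ideal_cases: "lie_ideal sm br I \<Longrightarrow> I = {0} \<or> I = UNIV"
  using simple by (simp add: simple_lie_algebra_def)

lemma nonabelian: "\<exists>u v. br u v \<noteq> 0"
  using simple by (simp add: simple_lie_algebra_def)

text \<open>\<open>card\<close> is 0 on infinite types, so \<open>card_k\<close> excludes exactly
  the two-element field. Every use of that hypothesis goes through this scalar.\<close>

lemma obtain_third_scalar:
  obtains s :: 'k where "s \<noteq> 0" "s \<noteq> 1"
proof -
  have "(UNIV :: 'k set) \<noteq> {0, 1}"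
    using card_k by (metis card_2_iff zero_neq_one)
  then show thesis using that by blast
qed

text \<open>The points 0, 1 and a third scalar determine a polynomial of degree at most 2, also with
  vector coefficients.\<close>

lemma quadratic_coeffs_zero:
  assumes "\<And>s. A + s *s B + (s\<^sup>2) *s C = 0"
  shows "A = 0" "B = 0" "C = 0"
proof -
  obtain s :: 'k where s: "s \<noteq> 0" "s \<noteq> 1" by (rule obtain_third_scalar)
  show A: "A = 0" using assms[of 0] by simp
  have BC: "B = - C" using assms[of 1] A by (simp add: eq_neg_iff_add_eq_0)
  have "(s\<^sup>2 - s) *s C = 0" using assms[of s] A BC by (simp add: algebra_simps)
  moreover have "s\<^sup>2 - s \<noteq> 0" using s by (simp add: power2_eq_square)
  ultimately show "C = 0" by simp
  with BC show "B = 0" by simp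
qed

section \<open>Exponential automorphisms of extremal elements\<close>

text \<open>Putting u = e into \<open>ext_premet1\<close> gives g(e,e)[e,w] = g(e,[e,w])e. If g(e,e)
  were nonzero, ke would be an ideal, hence all of L, and L would be abelian.\<close>

lemma g_ext_self: assumes "ext e" shows "g e e = 0"
proof (rule ccontr)
  assume ne: "g e e \<noteq> 0"
  have br_in: "br e w \<in> span {e}" for w
  proof -
    have "g e e *s br e w = g e (br e w) *s e"
      using ext_premet1[OF assms, of e w] by simp
    then have "br e w = (g e (br e w) / g e e) *s e"
      using ne by (metis scale_scale scale_one nonzero_divide_eq_eq divide_inverse mult.commute
          left_inverse)
    then show ?thesis by (metis span_base span_scale singletonI)
  qed
  have "lie_ideal sm br (span {e})"
    unfolding lie_ideal_def
  proof (intro conjI allI impI)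
    fix u v assume "v \<in> span {e}"
    then obtain a where "v = a *s e" by (auto simp: span_singleton)
    then have "br u v = - (a *s br e u)" using br_skew[of u e] by simp
    then show "br u v \<in> span {e}" using br_in by (simp add: span_neg span_scale)
  qed simp
  then have "span {e} = UNIV"
    using ideal_cases ext_nonzero[OF assms] span_base[of e "{e}"] by blast
  then have "\<exists>a. u = a *s e" for u by (auto simp: span_singleton)
  then have "br u v = 0" for u v
    by (metis br_scale_left br_scale_right br_self scale_zero_right)
  then show False using nonabelian by blast
qed

lemma g_ext_br: assumes "ext e" shows "g e (br e w) = 0"
  using ext_premet1[OF assms, of e w] g_ext_self[OF assms] ext_nonzero[OF assms] by simp

text \<open>The exponential of t ad e: as ad e squared sends u to 2 g(e,u) e, the formula avoids the
  division by 2.\<close>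

definition exp_ext :: "'v \<Rightarrow> 'k \<Rightarrow> 'v \<Rightarrow> 'v" where
  "exp_ext e t u = u + t *s br e u + (t\<^sup>2 * g e u) *s e"

lemma exp_ext_add: "exp_ext e t (u + v) = exp_ext e t u + exp_ext e t v"
  by (simp add: exp_ext_def algebra_simps)

lemma exp_ext_scale: "exp_ext e t (a *s u) = a *s exp_ext e t u"
  by (simp add: exp_ext_def algebra_simps)

lemma exp_ext_minus: "exp_ext e t (- u) = - exp_ext e t u"
  by (simp add: exp_ext_def algebra_simps)

lemma exp_ext_diff: "exp_ext e t (u - v) = exp_ext e t u - exp_ext e t v"
  using exp_ext_add[of e t u "- v"] by (simp add: exp_ext_minus)

lemma exp_ext_inverse: assumes "ext e" shows "exp_ext e (- t) (exp_ext e t u) = u"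
proof -
  have 1: "exp_ext e (- t) e = e" by (simp add: exp_ext_def g_ext_self[OF assms])
  have 2: "exp_ext e (- t) (br e u) = br e u - (t * (2 * g e u)) *s e"
    by (simp add: exp_ext_def g_ext_br[OF assms] ext_br_br[OF assms])
  have 3: "t * (t * (2 * g e u)) = t\<^sup>2 * g e u + t\<^sup>2 * g e u"
    by (simp add: power2_eq_square)
  have "exp_ext e (- t) (exp_ext e t u) = exp_ext e (- t) (u + t *s br e u + (t\<^sup>2 * g e u) *s e)"
    by (simp only: exp_ext_def[of e t u])
  also have "\<dots> = (u - t *s br e u + (t\<^sup>2 * g e u) *s e)
      + t *s (br e u - (t * (2 * g e u)) *s e) + (t\<^sup>2 * g e u) *s e"
    by (simp only: exp_ext_add exp_ext_scale 1 2) (simp add: exp_ext_def)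
  also have "\<dots> = u"
    by (simp only: scale_right_diff_distrib scale_scale 3 scale_left_distrib) simp
  finally show ?thesis .
qed

lemma exp_ext_inverse': "ext e \<Longrightarrow> exp_ext e t (exp_ext e (- t) u) = u"
  using exp_ext_inverse[of e "- t"] by simp

lemma exp_ext_eq_iff: "ext e \<Longrightarrow> exp_ext e t u = exp_ext e t v \<longleftrightarrow> u = v"
  by (metis exp_ext_inverse)

lemma exp_ext_zero: "exp_ext e t 0 = 0"
  by (simp add: exp_ext_def)

text \<open>Compare powers of t: the linear term is the Jacobi identity, the quadratic term is
  \<open>ext_premet1\<close>, and the two cubic terms cancel by \<open>ext_br_br\<close>.\<close>

lemma exp_ext_br: assumes "ext e" shows "exp_ext e t (br u w) = br (exp_ext e t u) (exp_ext e t w)"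
proof -
  have sk: "br u e = - br e u" "br (br e u) e = - br e (br e u)"
    by (rule br_skew)+
  have t3: "t * (t\<^sup>2 * x) = t^3 * x" "t\<^sup>2 * (t * x) = t^3 * x" "t * (t * x) = t\<^sup>2 * x" for x
    by (simp_all add: power2_eq_square power3_eq_cube)
  have "br (exp_ext e t u) (exp_ext e t w) = br u w + t *s (br (br e u) w + br u (br e w))
      + t\<^sup>2 *s (br (br e u) (br e w) + g e u *s br e w - g e w *s br e u)"
    by (simp add: exp_ext_def algebra_simps sk ext_br_br[OF assms] t3 power2_eq_square[symmetric])
  also have "\<dots> = exp_ext e t (br u w)"
    by (simp add: exp_ext_def ext_premet1[OF assms] jacobi[of e u w])
  finally show ?thesis by simp
qed

text \<open>Transport of structure. Going from the image back to z takes only injectivity of the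
  exponential; the other direction follows by using \<open>- t\<close>.\<close>

lemma exp_ext_extremal_identities:
  assumes "ext e" and "extremal_identities sm br (exp_ext e t z) f"
  shows "extremal_identities sm br z (\<lambda>u. f (exp_ext e t u))"
proof -
  let ?p = "exp_ext e t"
  note [simp] = exp_ext_br[OF assms(1)] exp_ext_add exp_ext_scale exp_ext_diff
  have "?p (br z (br z u)) = ?p ((2 * f (?p u)) *s z)" for u
    using assms(2) by (simp add: extremal_identities_def)
  moreover have "?p (br (br z u) (br z w)) =
      ?p (f (?p (br u w)) *s z + f (?p w) *s br z u - f (?p u) *s br z w)" for u w
    using assms(2) by (simp add: extremal_identities_def)
  moreover have "?p (br z (br u (br z w))) =
      ?p (f (?p (br u w)) *s z - f (?p w) *s br z u - f (?p u) *s br z w)" for u w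
    using assms(2) by (simp add: extremal_identities_def)
  ultimately show ?thesis
    unfolding extremal_identities_def exp_ext_eq_iff[OF assms(1)] by blast
qed

lemma ext_exp_ext: assumes "ext e" "ext z" shows "ext (exp_ext e t z)"
proof (rule extI)
  show "exp_ext e t z \<noteq> 0" using ext_nonzero[OF assms(2)] exp_ext_eq_iff[OF assms(1), of t z 0] exp_ext_zero by simp
  have "extremal_identities sm br (exp_ext e (- t) (exp_ext e t z)) (g z)"
    using ext_identities[OF assms(2)] by (simp add: exp_ext_inverse[OF assms(1)])
  then show "extremal_identities sm br (exp_ext e t z) (\<lambda>u. g z (exp_ext e (- t) u))"
    by (rule exp_ext_extremal_identities[OF assms(1)])
qed

lemma sandwich_exp_ext: assumes "ext e" "sandwich br (exp_ext e t z)" shows "sandwich br z"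
proof -
  let ?p = "exp_ext e t"
  note [simp] = exp_ext_br[OF assms(1)]
  have "?p (br z (br z u)) = ?p 0" for u
    using assms(2) by (simp add: sandwich_def exp_ext_zero)
  moreover have "?p (br z (br u (br z w))) = ?p 0" for u w
    using assms(2) by (simp add: sandwich_def exp_ext_zero)
  ultimately show ?thesis
    unfolding sandwich_def exp_ext_eq_iff[OF assms(1)] by blast
qed

lemma pure_exp_ext: "\<lbrakk>ext e; pure z\<rbrakk> \<Longrightarrow> pure (exp_ext e t z)"
  using ext_exp_ext sandwich_exp_ext unfolding pure_extremal_def by blast

section \<open>Ideals from stable spans; L is spanned by its pure elements\<close>

text \<open>By the Jacobi identity the elements whose bracket preserves the span form a subalgebra.
  It contains the generators, so it is L.\<close>

lemma stable_ideal:
  assumes "\<And>e c. pure e \<Longrightarrow> c \<in> C \<Longrightarrow> br e c \<in> span C"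
  shows "lie_ideal sm br (span C)"
proof -
  let ?A = "{a. \<forall>v\<in>span C. br a v \<in> span C}"
  have pure_in: "br e v \<in> span C" if "pure e" "v \<in> span C" for e v
    using that(2)
  proof (induction rule: span_induct_alt)
    case (step a c v)
    then show ?case
      using assms[OF that(1)] by (simp add: br_add_right span_add span_scale)
  qed (simp add: span_zero)
  have "lie_subalgebra sm br ?A"
    unfolding lie_subalgebra_def
  proof (intro conjI ballI)
    show "subspace ?A"
      by (rule subspaceI) (simp_all add: br_add_left span_add span_scale span_zero)
    fix u v assume *: "u \<in> ?A" "v \<in> ?A"
    have "br (br u v) w = br u (br v w) - br v (br u w)" for w
      using jacobi[of u v w] by simp
    then show "br u v \<in> ?A"
      using * by (simp add: span_diff)
  qed
  then have "lie_generated sm br {z. pure z} \<subseteq> ?A"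
    unfolding lie_generated_def using pure_in by (intro Inter_lower) auto
  then show ?thesis
    unfolding lie_ideal_def gen by auto
qed

text \<open>Since br e c = exp_ext e 1 c - c - g e c e, a span closed under the exponentials is
  an ideal as soon as the last summand is under control.\<close>

lemma exp_ext_closed_spans:
  assumes closed: "\<And>e c t. pure e \<Longrightarrow> c \<in> C \<Longrightarrow> exp_ext e t c \<in> C"
    and "c0 \<in> C" "c0 \<noteq> 0" and ext_pure: "\<And>e. pure e \<Longrightarrow> e \<in> span C \<or> (\<forall>c\<in>C. g e c = 0)"
  shows "span C = UNIV"
proof -
  have "br e c \<in> span C" if "pure e" "c \<in> C" for e c
  proof -
    have "br e c = exp_ext e 1 c - c - g e c *s e" by (simp add: exp_ext_def)
    moreover have "g e c *s e \<in> span C"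
      using ext_pure[OF that(1)] that(2) by (auto intro: span_scale simp: span_zero)
    ultimately show ?thesis
      using closed[OF that, of 1] that(2) by (simp add: span_diff span_base)
  qed
  then have "lie_ideal sm br (span C)" by (rule stable_ideal)
  then show ?thesis using ideal_cases assms(2,3) span_base by blast
qed

lemma exists_pure: "\<exists>z. pure z"
proof (rule ccontr)
  assume "\<nexists>z. pure z"
  then have "lie_generated sm br {z. pure z} \<subseteq> {0}"
    unfolding lie_generated_def
    by (intro Inter_lower) (auto simp: lie_subalgebra_def)
  then have "UNIV = {0::'v}" using gen by auto
  then show False using nonabelian by (metis UNIV_I singletonD)
qed

lemma span_pure: "span {z. pure z} = UNIV"
proof -
  obtain z where "pure z" using exists_pure by blast
  then show ?thesis
    using exp_ext_closed_spans[of "{z. pure z}" z] pure_exp_ext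
    by (auto simp: pure_extremal_def span_base dest: ext_nonzero)
qed

section \<open>Invariance, associativity and nondegeneracy of the form\<close>

text \<open>If f and f' differ at u0, then [z,[z,u]] = 2f(u)z forces characteristic 2, so ad z
  squares to 0. Subtracting the second identities for f and f' puts [z,L] into the span of z and h =
  [z,u0], and this makes z a sandwich.\<close>

lemma pure_form_unique:
  assumes "pure z" and f: "extremal_identities sm br z f" and f': "extremal_identities sm br z f'"
  shows "f u0 = f' u0"
proof (rule ccontr)
  assume "f u0 \<noteq> f' u0"
  define d where "d = (\<lambda>u. f u - f' u)"
  have d0: "d u0 \<noteq> 0" using \<open>f u0 \<noteq> f' u0\<close> by (simp add: d_def)
  have z0: "z \<noteq> 0" using assms(1) ext_nonzero by (simp add: pure_extremal_def)
  have "(2 * f u0) *s z = (2 * f' u0) *s z"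
    using f f' unfolding extremal_identities_def by metis
  then have "(2 * d u0) *s z = 0" by (simp add: d_def algebra_simps)
  then have two: "(2::'k) = 0" using z0 d0 by simp
  have zz: "br z (br z u) = 0" for u
    using f two by (simp add: extremal_identities_def)
  define h where "h = br z u0"
  have "d u0 *s br z w = d (br u0 w) *s z + d w *s h" for w
  proof -
    have "f (br u0 w) *s z + f w *s br z u0 - f u0 *s br z w
        = f' (br u0 w) *s z + f' w *s br z u0 - f' u0 *s br z w"
      using f f' unfolding extremal_identities_def by metis
    then show ?thesis by (simp add: d_def h_def algebra_simps)
  qed
  then have "br z w = (inverse (d u0) * d (br u0 w)) *s z + (inverse (d u0) * d w) *s h" for w
    using d0 by (metis scale_right_distrib scale_scale scale_one left_inverse)
  then obtain p q where pq: "\<And>w. br z w = p w *s z + q w *s h"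
    by (rule that[where p = "\<lambda>w. inverse (d u0) * d (br u0 w)"])
  have zh: "br z h = 0" by (simp add: h_def zz)
  have "br z (br u (br z w)) = 0" for u w
  proof -
    have "br z (br u z) = 0" using zz[of u] br_skew[of u z] by simp
    moreover have "br z (br u h) = 0"
      using jacobi[of z u h] by (simp add: zh pq[of u] algebra_simps)
    ultimately show ?thesis by (simp add: pq[of w] br_add_right)
  qed
  then show False using assms(1) zz by (simp add: pure_extremal_def sandwich_def)
qed

text \<open>Pulling g back along the exponential gives a functional that again satisfies the
  extremal identities of z. For pure z uniqueness identifies it with \<open>g z\<close>, and the
  pure elements span L.\<close>

lemma g_exp_ext: assumes "ext e" shows "g (exp_ext e t z) (exp_ext e t u) = g z u"
proof -
  let ?A = "{z. \<forall>u. g (exp_ext e t z) (exp_ext e t u) = g z u}"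
  have "z \<in> ?A" if "pure z" for z
  proof -
    have "ext (exp_ext e t z)" using assms that by (simp add: ext_exp_ext pure_extremal_def)
    then have "extremal_identities sm br z (\<lambda>u. g (exp_ext e t z) (exp_ext e t u))"
      by (intro exp_ext_extremal_identities[OF assms] ext_identities)
    moreover have "extremal_identities sm br z (g z)"
      using that by (simp add: pure_extremal_def ext_identities)
    ultimately show ?thesis using pure_form_unique[OF that] by blast
  qed
  moreover have "subspace ?A"
    by (rule subspaceI) (simp_all add: exp_ext_add exp_ext_scale exp_ext_zero g_add_left)
  ultimately have "span {z. pure z} \<subseteq> ?A" by (intro span_minimal) auto
  then show ?thesis unfolding span_pure by blast
qed

text \<open>Compare coefficients in the invariance of g under exp_ext e s. This is quadratic in s
  without constant term, so two nonzero values of s are needed.\<close>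

lemma g_br_ext: assumes "ext e" shows "g (br e u) w = - g u (br e w)"
proof -
  define A where "A = g (br e u) w + g u (br e w)"
  define B where "B = g (br e u) (br e w) + 2 * g e u * g e w"
  have AB: "s * A + s\<^sup>2 * B = 0" for s
  proof -
    have "g (exp_ext e s u) (exp_ext e s w) = g u w + (s * A + s\<^sup>2 * B)"
      using g_ext_br[OF assms, of u] g_sym[of "br e u" e]
      by (simp add: exp_ext_def A_def B_def g_add_left g_add_right g_ext_self[OF assms]
          g_ext_br[OF assms] g_sym[of u e] algebra_simps power2_eq_square)
    then show ?thesis by (simp add: g_exp_ext[OF assms])
  qed
  obtain s :: 'k where s: "s \<noteq> 0" "s \<noteq> 1" by (rule obtain_third_scalar)
  have "A = - B" using AB[of 1] by (simp add: eq_neg_iff_add_eq_0)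
  then have "s * (s - 1) * B = 0" using AB[of s] by (simp add: algebra_simps power2_eq_square)
  then have "A = 0" using s \<open>A = - B\<close> by simp
  then show ?thesis by (simp add: A_def eq_neg_iff_add_eq_0)
qed

lemma g_br: "g (br a u) w = - g u (br a w)"
proof -
  let ?A = "{a. g (br a u) w = - g u (br a w)}"
  have "subspace ?A"
    by (rule subspaceI) (simp_all add: br_add_left g_add_left g_add_right)
  moreover have "{z. pure z} \<subseteq> ?A"
    using g_br_ext by (auto simp: pure_extremal_def)
  ultimately have "span {z. pure z} \<subseteq> ?A" by (intro span_minimal)
  then show ?thesis unfolding span_pure by blast
qed

lemma g_assoc: "g (br a b) c = g a (br b c)"
  using g_br[of b a c] br_skew[of a b] by simp

text \<open>Associativity makes the radical of g an ideal. If it were L, the extremal identities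
  with g = 0 would turn every pure element into a sandwich.\<close>

lemma nondegenerate: assumes "\<And>v. g u v = 0" shows "u = 0"
proof -
  let ?R = "{u. \<forall>v. g u v = 0}"
  have "lie_ideal sm br ?R"
    unfolding lie_ideal_def
    by (auto intro!: subspaceI simp: g_add_left g_br)
  moreover have "?R \<noteq> UNIV"
  proof
    assume "?R = UNIV"
    then have "g u v = 0" for u v by blast
    moreover obtain z where "pure z" using exists_pure by blast
    ultimately show False
      using ext_br_br[of z] ext_premet2[of z]
      by (simp add: pure_extremal_def sandwich_def)
  qed
  ultimately show ?thesis using ideal_cases[of ?R] assms by blast
qed

section \<open>Conjugacy of extremal elements\<close>

text \<open>This is a Weyl element of SL_2 acting on x; of its three factors, the one applied first
  is an exponential of x and fixes x.\<close>

lemma exp_ext_swap: assumes "ext x" "ext y" "g x y = 1" shows "exp_ext x 1 (exp_ext y 1 x) = y"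
proof -
  have "br y x = - br x y" by (rule br_skew)
  then show ?thesis
    using assms(3) ext_br_br[OF assms(1), of y]
    by (simp add: exp_ext_def g_sym[of y x] g_add_right br_add_right g_ext_self[OF assms(1)]
        g_ext_br[OF assms(1)] algebra_simps) (use scale_left_distrib[of 1 1 x] in simp)
qed

text \<open>An induction principle in place of transitivity of the group generated by exponentials.
  An element not orthogonal to some c in C is, up to a scalar, the image of c under
  \<open>exp_ext_swap\<close>. Since C spans L and g is nondegenerate, every extremal e has such a
  c.\<close>

lemma all_ext_conjugate:
  assumes "\<And>c. c \<in> C \<Longrightarrow> ext c" and "c0 \<in> C"
    and exp_ext: "\<And>e t c. \<lbrakk>ext e; c \<in> C\<rbrakk> \<Longrightarrow> exp_ext e t c \<in> C"
    and scale: "\<And>a c. \<lbrakk>c \<in> C; a \<noteq> 0\<rbrakk> \<Longrightarrow> a *s c \<in> C"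
    and e: "ext e"
  shows "e \<in> C"
proof -
  have opp: "e \<in> C" if "ext e" "c \<in> C" "g e c \<noteq> 0" for e c
  proof -
    let ?e = "inverse (g e c) *s e"
    have "g c ?e = 1" using that(3) by (simp add: g_sym[of c])
    moreover have "ext ?e" using that by (simp add: ext_scale)
    ultimately have "?e \<in> C"
      using exp_ext_swap[of c ?e] assms(1)[OF that(2)] that(2) exp_ext by metis
    then have "g e c *s ?e \<in> C" using that(3) by (rule scale)
    then show ?thesis using that(3) by simp
  qed
  have span: "span C = UNIV"
  proof (rule exp_ext_closed_spans)
    show "exp_ext e t c \<in> C" if "pure e" "c \<in> C" for e c t
      using that exp_ext by (simp add: pure_extremal_def)
    show "e \<in> span C \<or> (\<forall>c\<in>C. g e c = 0)" if "pure e" for e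
      using that opp[of e] span_base[of e C] unfolding pure_extremal_def by blast
    show "c0 \<in> C" by fact
    show "c0 \<noteq> 0" using assms(1,2) ext_nonzero by blast
  qed
  have "\<exists>c\<in>C. g e c \<noteq> 0"
  proof (rule ccontr)
    assume *: "\<not> ?thesis"
    have "subspace {v. g e v = 0}" by (rule subspaceI) (simp_all add: g_add_right)
    then have "span C \<subseteq> {v. g e v = 0}" using * by (intro span_minimal) auto
    then show False using nondegenerate[of e] ext_nonzero[OF e] span by auto
  qed
  then show ?thesis using opp[OF e] by blast
qed

text \<open>Up to scalars all extremal elements are conjugate, so one pure element makes them all pure.\<close>

lemma ext_pure: assumes "ext e" shows "pure e"
proof -
  obtain c where "pure c" using exists_pure by blast
  have "pure (a *s z)" if "pure z" "a \<noteq> 0" for a z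
    using that by (simp add: pure_extremal_def ext_scale sandwich_def)
  then have "e \<in> {z. pure z}"
    using \<open>pure c\<close> assms all_ext_conjugate[of "{z. pure z}" c e]
    by (simp add: pure_exp_ext) (simp add: pure_extremal_def)
  then show ?thesis by simp
qed

section \<open>Elements on lines\<close>

text \<open>The identities for a + sb hold for every s, trivially when this vector is 0, and are
  quadratic in s. Their top coefficients are the identities for b, which is not assumed extremal;
  linear coefficients give the mixed identities.\<close>

lemma line_identities:
  assumes "\<And>s. ext (a + s *s b) \<or> a + s *s b = 0"
  shows "extremal_identities sm br b (g b)"
    and "br (br a u) (br b w) + br (br b u) (br a w) = g a (br u w) *s b + g b (br u w) *s a
      + g a w *s br b u + g b w *s br a u - g a u *s br b w - g b u *s br a w"
    and "br a (br b u) + br b (br a u) = (2 * g a u) *s b + (2 * g b u) *s a"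
proof -
  have ids: "extremal_identities sm br (a + s *s b) (g (a + s *s b))" for s
  proof (cases "a + s *s b = 0")
    case True
    show ?thesis unfolding True by (simp add: extremal_identities_def)
  qed (use assms[of s] ext_identities in blast)
  note i = ids[unfolded extremal_identities_def]
  have q1: "(br a (br a u) - (2 * g a u) *s a)
      + s *s (br a (br b u) + br b (br a u) - (2 * g a u) *s b - (2 * g b u) *s a)
      + s\<^sup>2 *s (br b (br b u) - (2 * g b u) *s b) = 0" for s u
    using i[of s, THEN conjunct1, rule_format, of u]
    by (simp add: algebra_simps power2_eq_square)
  have q2: "(br (br a u) (br a w) - (g a (br u w) *s a + g a w *s br a u - g a u *s br a w))
      + s *s (br (br a u) (br b w) + br (br b u) (br a w) - (g a (br u w) *s b + g b (br u w) *s a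
      + g a w *s br b u + g b w *s br a u - g a u *s br b w - g b u *s br a w))
      + s\<^sup>2 *s (br (br b u) (br b w) - (g b (br u w) *s b + g b w *s br b u - g b u *s br b w)) = 0"
    for s u w
    using i[of s, THEN conjunct2, THEN conjunct1, rule_format, of u w]
    by (simp add: algebra_simps power2_eq_square)
  have q3: "(br a (br u (br a w)) - (g a (br u w) *s a - g a w *s br a u - g a u *s br a w))
      + s *s (br a (br u (br b w)) + br b (br u (br a w)) - (g a (br u w) *s b + g b (br u w) *s a
      - g a w *s br b u - g b w *s br a u - g a u *s br b w - g b u *s br a w))
      + s\<^sup>2 *s (br b (br u (br b w)) - (g b (br u w) *s b - g b w *s br b u - g b u *s br b w)) = 0"
    for s u w
    using i[of s, THEN conjunct2, THEN conjunct2, rule_format, of u w]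
    by (simp add: algebra_simps power2_eq_square)
  show "extremal_identities sm br b (g b)"
    unfolding extremal_identities_def
    using quadratic_coeffs_zero(3)[OF q1] quadratic_coeffs_zero(3)[OF q2]
      quadratic_coeffs_zero(3)[OF q3] by simp
  show "br (br a u) (br b w) + br (br b u) (br a w) = g a (br u w) *s b + g b (br u w) *s a
      + g a w *s br b u + g b w *s br a u - g a u *s br b w - g b u *s br a w"
    using quadratic_coeffs_zero(2)[OF q2, of u w] by simp
  show "br a (br b u) + br b (br a u) = (2 * g a u) *s b + (2 * g b u) *s a"
    using quadratic_coeffs_zero(2)[OF q1, of u] by (simp add: algebra_simps)
qed

text \<open>For l = 0, all z + s[x,z] are images of z under exponentials of x, so their direction
  [x,z] inherits the identities. For l nonzero, the vector is l times the image of x under an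
  exponential of z.\<close>

lemma ext_br_or_zero:
  assumes "ext x" "ext z" "g x z = 0"
  shows "ext (br x z + l *s x) \<or> br x z + l *s x = 0"
proof (cases "l = 0")
  case True
  have "ext (z + s *s br x z)" for s
    using ext_exp_ext[OF assms(1,2), of s] assms(3) by (simp add: exp_ext_def)
  then have "extremal_identities sm br (br x z) (g (br x z))"
    by (intro line_identities(1)) blast
  then show ?thesis using True extI by auto
next
  case False
  have "ext (l *s exp_ext z (- inverse l) x)"
    using assms False by (intro ext_scale ext_exp_ext)
  moreover have "l *s exp_ext z (- inverse l) x = br x z + l *s x"
    using False br_skew[of z x] assms(3) by (simp add: exp_ext_def g_sym[of z] scale_right_distrib)
  ultimately show ?thesis by simp
qed

section \<open>The 5-grading and the map \<open>rho\<close> onto L_{-1}\<close>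

definition hyperbolic :: "'v \<Rightarrow> 'v \<Rightarrow> bool" where
  "hyperbolic x y \<longleftrightarrow> ext x \<and> ext y \<and> g x y = 1"

lemma hyperbolic_sym: "hyperbolic x y \<Longrightarrow> hyperbolic y x"
  by (simp add: hyperbolic_def g_sym[of x])

lemma hyperbolicD: assumes "hyperbolic x y" shows "ext x" "ext y" "g x y = 1" "g y x = 1"
  using assms by (simp_all add: hyperbolic_def g_sym[of y])

abbreviation Lm :: "'v \<Rightarrow> 'v \<Rightarrow> 'v set" where "Lm \<equiv> grading_Lm1 br g"

text \<open>In terms of the 5-grading, rho x y z is the bracket of x with the L_1-component of z; the
  formula needs no decomposition of z and also works in characteristic 2, where U does
  not complement the span of x, y and [x,y].\<close>

definition rho :: "'v \<Rightarrow> 'v \<Rightarrow> 'v \<Rightarrow> 'v" where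
  "rho x y z = br x z - g x z *s br x y + g (br x y) z *s x"

lemma rho_add: "rho x y (u + v) = rho x y u + rho x y v"
  by (simp add: rho_def algebra_simps)

lemma rho_scale: "rho x y (a *s u) = a *s rho x y u"
  by (simp add: rho_def algebra_simps)

lemma rho_minus: "rho x y (- u) = - rho x y u"
  by (simp add: rho_def algebra_simps)

lemma subspace_Lm: "subspace (Lm x y)"
proof (rule subspaceI)
  have "0 \<in> grading_U br g x y" by (simp add: grading_U_def)
  then show "0 \<in> Lm x y" unfolding grading_Lm1_def by force
next
  fix u v assume "u \<in> Lm x y" "v \<in> Lm x y"
  then obtain p q where "u = br x p" "v = br x q" "p \<in> grading_U br g x y" "q \<in> grading_U br g x y"
    unfolding grading_Lm1_def by auto
  then have "u + v = br x (p + q)" "p + q \<in> grading_U br g x y"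
    by (simp_all add: grading_U_def g_add_left br_add_right)
  then show "u + v \<in> Lm x y" unfolding grading_Lm1_def by blast
next
  fix a u assume "u \<in> Lm x y"
  then obtain p where "u = br x p" "p \<in> grading_U br g x y"
    unfolding grading_Lm1_def by auto
  then have "a *s u = br x (a *s p)" "a *s p \<in> grading_U br g x y"
    by (simp_all add: grading_U_def)
  then show "a *s u \<in> Lm x y" unfolding grading_Lm1_def by blast
qed

lemma Lm_D:
  assumes "hyperbolic x y" "a \<in> Lm x y"
  shows "br x a = 0" "br a x = 0" "g x a = 0" "g a x = 0" "g y a = 0" "g a y = 0"
    "br (br x y) a = - a" "g (br x y) a = 0" "br x (br y a) = - a" "rho x y a = 0"
proof -
  note D = hyperbolicD[OF assms(1)]
  obtain u where u: "a = br x u" "g u x = 0" "g u y = 0" "g u (br x y) = 0"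
    using assms(2) by (auto simp: grading_Lm1_def grading_U_def)
  note u' = u(2-4)[unfolded g_sym[of u]]
  have gyu: "g x (br y u) = 0" "g x (br u y) = 0"
    using g_assoc[of x y u] u' br_skew[of u y] by simp_all
  show 1: "br x a = 0" by (simp add: u ext_br_br[OF D(1)] u')
  then show "br a x = 0" using br_skew[of a x] by simp
  show 2: "g x a = 0" by (simp add: u g_ext_br[OF D(1)])
  then show "g a x = 0" by (simp add: g_sym)
  show 3: "g a y = 0" using g_assoc[of x u y] gyu by (simp add: u(1))
  then show "g y a = 0" by (simp add: g_sym)
  have "br a (br x y) = a"
    using ext_premet1[OF D(1), of u y] gyu by (simp add: u(1) D(3) u')
  then show "br (br x y) a = - a" using br_skew[of "br x y" a] by simp
  have "g a (br x y) = - g (br x a) y" by (simp add: g_br)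
  then show 4: "g (br x y) a = 0" by (simp add: 1 g_sym)
  show "br x (br y a) = - a"
    using ext_premet2[OF D(1), of y u] gyu by (simp add: u(1) D(3) u')
  show "rho x y a = 0" by (simp add: rho_def 1 2 4)
qed

lemma hyperbolic_br:
  assumes "hyperbolic x y"
  shows "br x (br x y) = 2 *s x" "br y (br x y) = - (2 *s y)"
    "g x (br x y) = 0" "g y (br x y) = 0" "g (br x y) x = 0" "g (br x y) y = 0"
proof -
  note D = hyperbolicD[OF assms]
  show "br x (br x y) = 2 *s x" by (simp add: ext_br_br D)
  show "br y (br x y) = - (2 *s y)" using ext_br_br[OF D(2), of x] D br_skew[of x y] by simp
  show 1: "g x (br x y) = 0" by (simp add: g_ext_br D)
  show 2: "g y (br x y) = 0" using g_ext_br[OF D(2), of x] br_skew[of y x] by simp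
  show "g (br x y) x = 0" "g (br x y) y = 0" using 1 2 by (simp_all add: g_sym)
qed

text \<open>The preimage in U is \<open>- br y ?a\<close>: the identities of x show that ad x ad y
  acts as -1 on \<open>?a\<close>, and associativity of g gives the orthogonality
  conditions.\<close>

lemma rho_in_Lm: assumes "hyperbolic x y" shows "rho x y z \<in> Lm x y"
proof -
  note D = hyperbolicD[OF assms] and H = hyperbolic_br[OF assms]
  let ?h = "br x y" and ?a = "rho x y z"
  have P: "br x (br y (br x z)) = g ?h z *s x - g x z *s ?h - br x z"
    using ext_premet2[OF D(1), of y z] by (simp add: D g_assoc)
  have xya: "br x (br y ?a) = - ?a"
  proof -
    have "br x (br y ?a) = (g ?h z *s x - g x z *s ?h - br x z) + (2 * g x z) *s ?h - (2 * g ?h z) *s x"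
      by (simp add: rho_def br_add_right br_diff_right P H D br_skew[of y x] mult.commute)
    then show ?thesis
      by (simp only: rho_def mult_2 scale_left_distrib) simp
  qed
  have xa: "br x ?a = 0"
    by (simp add: rho_def br_add_right br_diff_right H ext_br_br[OF D(1)] D mult.commute)
  have ga: "g ?a y = 0"
    using g_br[of x z y] by (simp add: rho_def g_add_left g_diff_left H D g_sym[of z])
  have "g (br y ?a) x = 0"
    using g_br[of y ?a x] g_br[of x ?a y] br_skew[of y x] by (simp add: xa)
  moreover have "g (br y ?a) y = 0" using g_ext_br[OF D(2)] by (simp add: g_sym)
  moreover have "g (br y ?a) ?h = 0"
    using g_br[of y ?a ?h] by (simp add: H ga)
  ultimately have "- br y ?a \<in> grading_U br g x y" by (simp add: grading_U_def)
  moreover have "?a = br x (- br y ?a)" by (simp add: xya)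
  ultimately show ?thesis unfolding grading_Lm1_def by (rule rev_image_eqI)
qed

text \<open>Surjectivity of \<open>rho x y\<close> onto L_{-1}. Since L is spanned by pure elements,
  it then suffices to place \<open>rho x y z\<close> in the span for extremal z.\<close>

lemma Lm_rho: assumes "hyperbolic x y" "a \<in> Lm x y" obtains z where "a = rho x y z"
proof
  note A = Lm_D[OF assms] and D = hyperbolicD[OF assms(1)] and H = hyperbolic_br[OF assms(1)]
  have "g (br x y) (br y a) = 0"
    using g_br[of "br x y" y a] g_assoc[of "br x y" y a] H A by simp
  moreover have "g x (br y a) = 0" using A by (simp add: g_assoc[symmetric])
  ultimately show "a = rho x y (- br y a)" by (simp add: rho_def A)
qed

section \<open>Images of extremal elements under \<open>rho\<close>\<close>

lemma rho_ext:
  assumes "hyperbolic x y" "ext z" "g x z = 0"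
  shows "ext (rho x y z) \<or> rho x y z = 0"
  using ext_br_or_zero[OF hyperbolicD(1)[OF assms(1)] assms(2,3)] assms(3) by (simp add: rho_def)

lemma rho_span:
  assumes "hyperbolic x y" "ext z" "g x z = 0"
  shows "rho x y z \<in> span (Lm x y \<inter> {z. ext z})"
  using rho_ext[OF assms] rho_in_Lm[OF assms(1), of z] by (auto simp: span_base span_zero)

lemma Lm_swap:
  assumes "hyperbolic x y" "c \<in> Lm x y" "ext c"
  shows "br y c \<in> Lm y x" "ext (br y c)"
proof -
  note A = Lm_D[OF assms(1,2)]
  have "rho y x c = br y c" using A br_skew[of y x] by (simp add: rho_def)
  moreover have "br y c \<noteq> 0" using A(9) ext_nonzero[OF assms(3)] by auto
  ultimately show "br y c \<in> Lm y x" "ext (br y c)"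
    using rho_in_Lm[OF hyperbolic_sym[OF assms(1)], of c] rho_ext[OF hyperbolic_sym[OF assms(1)] assms(3)] A
    by auto
qed

text \<open>Substitute c = [x,-[y,c]] into \<open>ext_premet1\<close> for x, and use [x,c] =
  0.\<close>

lemma br_Lm:
  assumes "hyperbolic x y" "c \<in> Lm x y"
  shows "br x (br c z) = g c z *s x + g x z *s c"
proof -
  note D = hyperbolicD[OF assms(1)] and C = Lm_D[OF assms]
  have "br (br x (- br y c)) (br x z) = g x (br (- br y c) z) *s x + g x z *s br x (- br y c)"
    using ext_premet1[OF D(1), of "- br y c" z] g_assoc[of x y c] by (simp add: C)
  moreover have "g x (br (br y c) z) = - g c z"
    using g_assoc[of x "br y c" z] by (simp add: C)
  ultimately show ?thesis
    using jacobi[of x c z] by (simp add: C)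
qed

text \<open>Here b is the element of L_1 that ad x sends to d; its exponential will move elements
  into the hyperplane orthogonal to x.\<close>

lemma opposite_Lm:
  assumes "hyperbolic x y" "d \<in> Lm x y" "ext d" "b = - br y d"
  shows "ext b" "br x b = d" "br b x = - d" "g x b = 0" "br (br x y) b = b" "g (br x y) b = 0" "rho x y b = d"
proof -
  note D = Lm_D[OF assms(1,2)] and S = Lm_swap[OF assms(1,2,3)]
  note B = Lm_D[OF hyperbolic_sym[OF assms(1)] S(1)]
  show "ext b" using ext_scale[OF S(2), of "-1"] assms(4) by simp
  show 1: "br x b = d" using D by (simp add: assms)
  then show "br b x = - d" using br_skew[of b x] by simp
  show 2: "g x b = 0" using B by (simp add: assms)
  show "br (br x y) b = b" using B br_skew[of y x] by (simp add: assms)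
  show 3: "g (br x y) b = 0" using B br_skew[of y x] by (simp add: assms)
  show "rho x y b = d" by (simp add: rho_def 1 2 3)
qed

text \<open>Choose s and t such that z moved by exp_ext c s and then by exp_ext b t is orthogonal
  to x, so that its rho is extremal or zero. Modulo the span this gives a relation that is affine
  in s; subtracting two instances isolates the coefficient of s.\<close>

lemma rho_congruence:
  assumes xy: "hyperbolic x y" and c: "c \<in> Lm x y" "ext c" and d: "d \<in> Lm x y" "ext d"
    and dc: "br d c = k *s x" "k \<noteq> 0" and b: "b = - br y d" and z: "ext z" and xz: "g x z \<noteq> 0"
  shows "k *s rho x y z - rho x y (br b (br c z)) \<in> span (Lm x y \<inter> {z. ext z})"
    (is "_ \<in> ?W")
proof -
  note C = Lm_D[OF xy c(1)] and D = Lm_D[OF xy d(1)] and B = opposite_Lm[OF xy d b]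
  let ?r = "rho x y"
  have cW: "c \<in> ?W" "d \<in> ?W" using c d by (auto intro: span_base)
  have gdc: "g d c = 0" using g_br[of x b c] by (simp add: B C)
  have gbc: "g b c = - k"
  proof -
    have "g b c = g d (br y c)" using g_br[of y d c] by (simp add: b)
    also have "\<dots> = - g (br d c) y" using g_assoc[of d c y] br_skew[of y c] by simp
    finally show ?thesis by (simp add: dc hyperbolicD[OF xy])
  qed
  have gxc: "g x (br c z) = 0" using g_assoc[of x c z] by (simp add: C)
  have rc: "?r (br c z) = g x z *s c"
    by (simp add: rho_def br_Lm[OF xy c(1)] gxc C g_assoc[of "br x y" c z, symmetric])
  have rbc: "?r (br b c) = 0"
    using jacobi[of x b c] g_assoc[of x b c]
    by (simp add: rho_def B C dc gdc gbc g_assoc[of "br x y" b c, symmetric])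
  have gdcz: "g d (br c z) = k * g x z" using g_assoc[of d c z] by (simp add: dc)
    \<comment> \<open>The value g(d, \<open>exp_ext c s z\<close>), which is the denominator of t
      below; \<open>key\<close> is multiplied by it.\<close>
    let ?q = "\<lambda>s. g d z + s * (k * g x z)"
    have key: "?q s *s ?r z - g x z *s (?r (br b z) + s *s ?r (br b (br c z))) \<in> ?W"
      if q: "?q s \<noteq> 0" for s
    proof -
      define z' where "z' = exp_ext c s z"
      define t where "t = - g x z / ?q s"
      have "ext z'" using z c(2) by (simp add: z'_def ext_exp_ext)
      have gdz': "g d z' = ?q s" by (simp add: z'_def exp_ext_def g_add_right gdcz gdc)
      have gxz': "g x z' = g x z" by (simp add: z'_def exp_ext_def g_add_right gxc C)
      have "g x (exp_ext b t z') = g x z + t * ?q s"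
        using g_assoc[of x b z'] by (simp add: exp_ext_def g_add_right B gdz' gxz')
      then have "g x (exp_ext b t z') = 0" using q by (simp add: t_def)
      then have "?r (exp_ext b t z') \<in> ?W"
        using \<open>ext z'\<close> B(1) by (intro rho_span[OF xy] ext_exp_ext)
      moreover have "?r (exp_ext b t z') = ?r z + t *s (?r (br b z) + s *s ?r (br b (br c z)))
          + ((s * g x z) *s c + (t\<^sup>2 * g b z') *s d)"
      proof -
        have "?r z' = ?r z + (s * g x z) *s c"
          by (simp add: z'_def exp_ext_def rho_add rho_scale rc C)
        moreover have "?r (br b z') = ?r (br b z) + s *s ?r (br b (br c z))"
          by (simp add: z'_def exp_ext_def rho_add rho_scale br_add_right rbc)
        moreover have "?r (exp_ext b t z') = ?r z' + t *s ?r (br b z') + (t\<^sup>2 * g b z') *s d"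
          by (simp add: exp_ext_def rho_add rho_scale B)
        ultimately show ?thesis by (simp add: add_ac)
      qed
      ultimately have "?r z + t *s (?r (br b z) + s *s ?r (br b (br c z))) \<in> ?W"
        using cW by (simp add: span_add_eq2 span_add span_scale)
      then have "?q s *s (?r z + t *s (?r (br b z) + s *s ?r (br b (br c z)))) \<in> ?W"
        by (rule span_scale)
      moreover have "?q s * t = - g x z" using q by (simp add: t_def)
      ultimately show ?thesis
        by (simp only: scale_right_distrib[of "?q s" "?r z"] scale_scale scale_minus_left) simp
    qed
    \<comment> \<open>\<open>?q\<close> is affine in s with nonzero slope, so at most one of 0, 1,
      s1 is a root and two admissible values remain.\<close>
    obtain s1 :: 'k where s1: "s1 \<noteq> 0" "s1 \<noteq> 1" by (rule obtain_third_scalar)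
    have inj: "s = s'" if "?q s = 0" "?q s' = 0" for s s'
    proof -
      have "s * (k * g x z) = s' * (k * g x z)" using that by (metis add_left_cancel)
      then show ?thesis using dc(2) xz by simp
    qed
    obtain s s' where s: "s \<noteq> s'" "?q s \<noteq> 0" "?q s' \<noteq> 0"
      using inj s1 zero_neq_one by metis
    define m where "m = (s - s') * g x z"
    have m0: "m \<noteq> 0" using s(1) xz by (simp add: m_def)
    have "m *s (k *s ?r z - ?r (br b (br c z))) \<in> ?W"
      using span_diff[OF key[OF s(2)] key[OF s(3)]]
      by (simp add: m_def algebra_simps)
    then have "inverse m *s (m *s (k *s ?r z - ?r (br b (br c z)))) \<in> ?W"
      by (rule span_scale)
    then show ?thesis
      using m0 by simp
qed

text \<open>After ad x is moved inwards, the difference collects [d,[c,z]] - [c,[d,z]] = k[x,z] and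
  [b,c] - [b',d] = k[x,y]; both come from [d,c] = kx, the second by applying ad y.\<close>

lemma rho_double_bracket:
  assumes xy: "hyperbolic x y" and c: "c \<in> Lm x y" "ext c" and d: "d \<in> Lm x y" "ext d"
    and dc: "br d c = k *s x" and b: "b = - br y d" and b': "b' = - br y c"
  shows "rho x y (br b (br c z)) - rho x y (br b' (br d z))
    = k *s rho x y z - g c z *s d + g d z *s c"
proof -
  note C = Lm_D[OF xy c(1)] and D = Lm_D[OF xy d(1)]
  note B = opposite_Lm[OF xy d b] and B' = opposite_Lm[OF xy c b']
  let ?h = "br x y" and ?u = "br b (br c z)" and ?v = "br b' (br d z)"
  have cd: "br c d = - (k *s x)" using br_skew[of c d] dc by simp
  have bc: "br b c - br b' d = k *s ?h"
  proof -
    have "br (br y c) d = br y (br c d) - br c (br y d)" using jacobi[of y c d] by simp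
    also have "\<dots> = k *s ?h - br b c"
      using br_skew[of y x] br_skew[of c b] by (simp add: cd b)
    finally show ?thesis by (simp add: b')
  qed
  have u: "br x ?u = br d (br c z) - g c z *s d + g x z *s br b c"
    using jacobi[of x b "br c z"] by (simp add: B br_Lm[OF xy c(1)] br_add_right)
  have v: "br x ?v = br c (br d z) - g d z *s c + g x z *s br b' d"
    using jacobi[of x b' "br d z"] by (simp add: B' br_Lm[OF xy d(1)] br_add_right)
  have "br x (?u - ?v) = (br d (br c z) - br c (br d z)) - g c z *s d + g d z *s c
      + g x z *s (br b c - br b' d)"
    by (simp add: br_diff_right u v scale_right_diff_distrib)
  also have "br d (br c z) - br c (br d z) = k *s br x z"
    using jacobi[of d c z] by (simp add: dc)
  finally have 1: "br x (?u - ?v) = k *s br x z - g c z *s d + g d z *s c + (k * g x z) *s ?h"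
    by (simp add: bc mult.commute)
  have "g x ?u = k * g x z" "g x ?v = - (k * g x z)"
    by (simp_all add: g_assoc[of x, symmetric] g_assoc[of _ _ z, symmetric] B B' dc cd)
  then have 2: "g x (?u - ?v) = k * g x z + k * g x z"
    by (simp add: g_diff_right)
  have 3: "g ?h (?u - ?v) = k * g ?h z"
    using g_assoc[of ?h b "br c z"] g_assoc[of ?h b' "br d z"] g_assoc[of b c z] g_assoc[of b' d z]
      arg_cong[OF bc, of "\<lambda>w. g w z"]
    by (simp add: g_diff_right g_diff_left B B')
  have "rho x y ?u - rho x y ?v = rho x y (?u - ?v)"
    using rho_add[of x y ?u "- ?v"] by (simp add: rho_minus)
  also have "\<dots> = k *s rho x y z - g c z *s d + g d z *s c"
    unfolding rho_def 1 2 3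
    by (simp only: scale_left_distrib scale_right_distrib scale_right_diff_distrib scale_scale) simp
  finally show ?thesis .
qed

text \<open>Exchanging c and d turns k into -k. The difference of the two congruences has
  coefficient 2k at \<open>rho x y z\<close>, and \<open>rho_double_bracket\<close> takes away k, so
  k remains in every characteristic.\<close>

lemma rho_ext_span:
  assumes xy: "hyperbolic x y" and c: "c \<in> Lm x y" "ext c" and d: "d \<in> Lm x y" "ext d"
    and dc: "br d c = k *s x" "k \<noteq> 0" and z: "ext z"
  shows "rho x y z \<in> span (Lm x y \<inter> {z. ext z})"
    (is "_ \<in> ?W")
proof (cases "g x z = 0")
  case False
  let ?u = "rho x y (br (- br y d) (br c z))" and ?v = "rho x y (br (- br y c) (br d z))"
  have W: "c \<in> ?W" "d \<in> ?W" using c d by (auto intro: span_base)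
  have cd: "br c d = (- k) *s x" using br_skew[of c d] dc by simp
  have "k *s rho x y z - ?u \<in> ?W"
    by (rule rho_congruence[OF xy c d dc refl z False])
  moreover have "(- k) *s rho x y z - ?v \<in> ?W"
    using dc(2) by (intro rho_congruence[OF xy d c cd _ refl z False]) simp
  ultimately have diff: "(k *s rho x y z - ?u) - ((- k) *s rho x y z - ?v) \<in> ?W"
    by (rule span_diff)
  have eq: "(k *s rho x y z - ?u) - ((- k) *s rho x y z - ?v)
      = k *s rho x y z + (g c z *s d - g d z *s c)"
  proof -
    have "(k *s rho x y z - ?u) - ((- k) *s rho x y z - ?v)
        = k *s rho x y z + k *s rho x y z - (?u - ?v)" by simp
    also have "\<dots> = k *s rho x y z + (g c z *s d - g d z *s c)"
      unfolding rho_double_bracket[OF xy c d dc(1) refl refl] by simp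
    finally show ?thesis .
  qed
  have "g c z *s d - g d z *s c \<in> ?W" using W by (simp add: span_diff span_scale)
  then have "k *s rho x y z \<in> ?W" using diff unfolding eq by (simp only: span_add_eq2)
  then show ?thesis using dc(2) span_scale[of "k *s rho x y z" _ "inverse k"] by simp
qed (rule rho_span[OF xy z])

section \<open>A non-commuting partner in L_{-1}, and the span of L_{-1}\<close>

lemma ext_detects: assumes "u \<noteq> 0" shows "\<exists>z. ext z \<and> g u z \<noteq> 0"
proof (rule ccontr)
  assume *: "\<not> ?thesis"
  have "subspace {v. g u v = 0}" by (rule subspaceI) (simp_all add: g_add_right)
  then have "span {z. pure z} \<subseteq> {v. g u v = 0}"
    using * by (intro span_minimal) (auto simp: pure_extremal_def)
  then show False using nondegenerate[of u] assms unfolding span_pure by blast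
qed

text \<open>Take z with g(c,z) nonzero. An exponential of [y,c] makes it orthogonal to x without
  changing g(c,z), because c commutes with [y,c]. The partner is \<open>rho x y\<close> of the
  result.\<close>

lemma exists_noncommuting_Lm:
  assumes xy: "hyperbolic x y" and c: "c \<in> Lm x y" "ext c"
  shows "\<exists>d k. d \<in> Lm x y \<and> ext d \<and> br d c = k *s x \<and> k \<noteq> 0"
proof -
  note X = hyperbolicD[OF xy] and C = Lm_D[OF xy c(1)] and S = Lm_swap[OF xy c]
  obtain z where z: "ext z" "g c z \<noteq> 0" using ext_detects ext_nonzero[OF c(2)] by blast
  \<comment> \<open>Solves g(x,w) = g(x,z) - t g(c,z) = 0.\<close>
  define t where "t = g x z / g c z"
  define w where "w = exp_ext (br y c) t z"
  have w: "ext w" using z S by (simp add: w_def ext_exp_ext)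
  have yc: "g x (br y c) = 0" "g c (br y c) = 0"
    using g_assoc[of x y c] C g_ext_br[OF c(2), of y] br_skew[of y c] by simp_all
  have "g x (br (br y c) z) = - g c z"
    using g_assoc[of x "br y c" z] C by simp
  then have gxw: "g x w = 0"
    using z(2) by (simp add: w_def exp_ext_def g_add_right yc t_def)
  have "br c (br y c) = 0"
    using ext_br_br[OF c(2), of y] br_skew[of y c] C by simp
  then have gcw: "g c w = g c z"
    using g_assoc[of c "br y c" z] by (simp add: w_def exp_ext_def g_add_right yc)
  let ?d = "rho x y w"
  have "br ?d c = - (br c (br x w) + g (br x y) w *s br c x)"
    using br_skew[of ?d c] by (simp add: rho_def gxw br_add_right)
  also have "br c (br x w) = br x (br c w)" using jacobi[of c x w] C by simp
  finally have "br ?d c = (- g c z) *s x"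
    by (simp add: br_Lm[OF xy c(1)] gxw gcw C)
  moreover from this have "?d \<noteq> 0" using z(2) ext_nonzero[OF X(1)] by auto
  ultimately show ?thesis
    using rho_ext[OF xy w gxw] rho_in_Lm[OF xy] z(2) by (metis neg_equal_0_iff_equal)
qed

lemma Lm_span:
  assumes xy: "hyperbolic x y" and c: "c \<in> Lm x y" "ext c"
  shows "Lm x y = span (Lm x y \<inter> {z. ext z})"
proof
  obtain d k where d: "d \<in> Lm x y" "ext d" "br d c = k *s x" "k \<noteq> 0"
    using exists_noncommuting_Lm[OF assms] by blast
  let ?W = "span (Lm x y \<inter> {z. ext z})"
  have "subspace {z. rho x y z \<in> ?W}"
    by (rule subspaceI)
      (simp_all add: rho_add rho_scale span_add span_scale, simp add: rho_def span_zero)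
  then have "span {z. pure z} \<subseteq> {z. rho x y z \<in> ?W}"
    using rho_ext_span[OF xy c d] by (intro span_minimal) (auto simp: pure_extremal_def)
  then have "rho x y z \<in> ?W" for z unfolding span_pure by blast
  then show "Lm x y \<subseteq> ?W" using Lm_rho[OF xy] by (metis subsetI)
  show "?W \<subseteq> Lm x y" by (rule span_minimal) (auto simp: subspace_Lm)
qed

section \<open>Existence of extremal elements in L_{-1}\<close>

text \<open>No extremal element forms a special (orthogonal, non-commuting) pair with x. This is the
  situation to be excluded.\<close>

definition commuting_polar :: "'v \<Rightarrow> bool" where
  "commuting_polar x \<longleftrightarrow> ext x \<and> (\<forall>w. ext w \<longrightarrow> g x w = 0 \<longrightarrow> br x w = 0)"

lemma commuting_polar_all:
  assumes "commuting_polar x" "ext e"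
  shows "commuting_polar e"
proof -
  have exp_ext: "commuting_polar (exp_ext e t c)" if "ext e" "commuting_polar c" for e t c
    unfolding commuting_polar_def
  proof (intro conjI allI impI)
    show "ext (exp_ext e t c)" using that by (simp add: commuting_polar_def ext_exp_ext)
    fix w assume w: "ext w" "g (exp_ext e t c) w = 0"
    let ?w = "exp_ext e (- t) w"
    have "g c ?w = 0" using g_exp_ext[OF that(1), of t c ?w] w by (simp add: exp_ext_inverse'[OF that(1)])
    then have "br c ?w = 0" using that w by (simp add: commuting_polar_def ext_exp_ext)
    then show "br (exp_ext e t c) w = 0"
      using exp_ext_br[OF that(1), of t c ?w] by (simp add: exp_ext_inverse'[OF that(1)] exp_ext_zero)
  qed
  have scale: "commuting_polar (a *s c)" if "commuting_polar c" "a \<noteq> 0" for a c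
    using that by (simp add: commuting_polar_def ext_scale)
  have "e \<in> {c. commuting_polar c}"
  proof (rule all_ext_conjugate)
    show "x \<in> {c. commuting_polar c}" using assms by simp
  qed (use exp_ext scale assms in \<open>auto simp: commuting_polar_def\<close>)
  then show ?thesis by simp
qed

text \<open>For w orthogonal to x, \<open>rho x y w\<close> is extremal or 0, hence 0, so [w,x] = lx
  for some l. Then l^2 x = [w,[w,x]] = 0.\<close>

lemma commuting_polarI:
  assumes xy: "hyperbolic x y" and none: "\<And>c. c \<in> Lm x y \<Longrightarrow> \<not> ext c"
  shows "commuting_polar x"
  unfolding commuting_polar_def
proof (intro conjI allI impI)
  show "ext x" by (rule hyperbolicD[OF xy])
  fix w assume w: "ext w" "g x w = 0"
  have "rho x y w = 0" using rho_ext[OF xy w] none rho_in_Lm[OF xy] by blast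
  then have 1: "br x w = (- g (br x y) w) *s x"
    by (simp add: rho_def w eq_neg_iff_add_eq_0)
  define l where "l = g (br x y) w"
  have "br w x = l *s x" using 1 br_skew[of w x] by (simp add: l_def)
  then have "(l * l) *s x = 0" using ext_br_br[OF w(1), of x] w(2) by (simp add: g_sym[of w])
  then show "br x w = 0" using 1 ext_nonzero[OF \<open>ext x\<close>] by (simp add: l_def)
qed

text \<open>On the line through a and a', pick p orthogonal to some w with g(a,w) = 1. Then ad a ad p
  vanishes on all extremal elements, hence everywhere, and this forces p to be a sandwich.\<close>

lemma commuting_polar_no_lines:
  assumes polar: "\<And>e. ext e \<Longrightarrow> commuting_polar e" and "collinear sm br a a'"
  shows False
proof -
  have com: "br e w = 0" if "ext e" "ext w" "g e w = 0" for e w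
    using polar that by (simp add: commuting_polar_def)
  have a: "ext a" "ext a'" "br a a' = 0" "range (\<lambda>c. c *s a) \<noteq> range (\<lambda>c. c *s a')"
    and comb: "\<And>c d. ext (c *s a + d *s a') \<or> c *s a + d *s a' = 0"
    using assms(2) by (simp_all add: collinear_def pure_extremal_def)
  obtain w0 where w0: "ext w0" "g a w0 \<noteq> 0" using ext_detects ext_nonzero[OF a(1)] by blast
  define w where "w = inverse (g a w0) *s w0"
  have w: "ext w" "g a w = 1" using w0 by (simp_all add: w_def ext_scale)
  define p where "p = a' - g a' w *s a"
  have p0: "p \<noteq> 0"
  proof
    assume "p = 0"
    then obtain l where l: "a' = l *s a" by (simp add: p_def)
    then have l0: "l \<noteq> 0" using ext_nonzero[OF a(2)] by auto
    have "c *s a = (c * inverse l) *s a'" "c *s a' = (c * l) *s a" for c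
      using l0 by (simp_all add: l)
    then have "range (\<lambda>c. c *s a) = range (\<lambda>c. c *s a')"
      by (metis (no_types, lifting) image_subset_iff rangeI subset_antisym)
    then show False using a(4) by simp
  qed
  have comb': "ext (c *s a + d *s p) \<or> c *s a + d *s p = 0" for c d
    using comb[of "c - d * g a' w" d] by (simp add: p_def algebra_simps)
  have p: "ext p" using comb'[of 0 1] p0 by simp
  have gpw: "g p w = 0" using w(2) by (simp add: p_def g_diff_left)
  have pw: "br p w = 0" by (rule com[OF p w(1) gpw])
  have ap: "br a p = 0" by (simp add: p_def br_diff_right a)
  note line = line_identities[of a p, OF comb'[of 1, simplified]]
  have S_ext: "br a (br p u) = 0" if u: "ext u" for u
  proof -
    have swap: "br a (br p u) = br p (br a u)" using jacobi[of a p u] ap by simp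
    show ?thesis
    proof (cases "g a u = 0 \<or> g p u = 0")
      case True
      then show ?thesis using com[OF a(1) u] com[OF p u] swap by auto
    next
      case False
      \<comment> \<open>The combination of a and p orthogonal to u, so it commutes with u. Applying
        ad a and ad p to the resulting relation gives 2g(p,u)a and 2g(a,u)p for the same vector;
        pairing with w separates them, as g(a,w) = 1 and g(p,w) = 0.\<close>
      let ?e = "g p u *s a + (- g a u) *s p"
      have "br ?e u = 0"
        using comb'[of "g p u" "- g a u"] u com[of ?e u] 
        by (auto simp: g_add_left g_diff_left mult.commute)
      then have e: "g p u *s br a u = g a u *s br p u"
        by (simp add: br_diff_left)
      have "g a u *s br a (br p u) = g a u *s ((2 * g p u) *s a)"
        using arg_cong[OF e, of "br a"] by (simp add: ext_br_br[OF a(1)] mult_ac)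
      then have Sa: "br a (br p u) = (2 * g p u) *s a"
        using False by (simp only: scale_cancel_left) simp
      have "g p u *s br p (br a u) = g p u *s ((2 * g a u) *s p)"
        using arg_cong[OF e, of "br p"] by (simp add: ext_br_br[OF p] mult_ac)
      then have Sp: "br p (br a u) = (2 * g a u) *s p"
        using False by (simp only: scale_cancel_left) simp
      have "g (br a (br p u)) w = 0"
        by (simp add: swap Sp gpw)
      then have "2 * g p u = 0" by (simp add: Sa w)
      then show ?thesis by (simp add: Sa)
    qed
  qed
  have S: "br a (br p u) = 0" for u
  proof -
    have "subspace {u. br a (br p u) = 0}" by (rule subspaceI) (simp_all add: br_add_right)
    then have "span {z. pure z} \<subseteq> {u. br a (br p u) = 0}"
      using S_ext by (intro span_minimal) (auto simp: pure_extremal_def)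
    then show ?thesis unfolding span_pure by blast
  qed
  have S': "br p (br a u) = 0" for u
    using jacobi[of a p u] ap S by simp
  define h where "h = br a w"
  \<comment> \<open>As p is nonzero, only characteristic 2 is left, where ad p squares to 0.\<close>
  have two: "2 *s p = 0" using line(3)[of w] by (simp add: S S' w gpw)
  have ph: "br p h = 0" by (simp add: h_def S')
  \<comment> \<open>[p,L] lies in the span of p and h, which yields the second sandwich identity.
    The formula comes from expanding [a,[p,[u,w]]] = 0 by the Jacobi identity and comparing with the
    mixed identity of the line.\<close>
  have form: "br p u = g p u *s h - g a (br u w) *s p" for u
  proof -
    have "br (br a u) (br p w) + br (br p u) (br a w) = 0"
    proof -
      have "0 = br (br a (br p u)) w + br (br p u) (br a w) + (br (br a u) (br p w) + br u (br a (br p w)))"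
        using S[of "br u w"] by (simp add: jacobi[of p u w] jacobi[of a _ "br _ w"]
          jacobi[of a _ w] br_add_right jacobi[of a u "br p w"])
      then show ?thesis by (simp add: S add.commute)
    qed
    moreover have "g p (br u w) = 0" using g_br[of w u p] g_assoc[of p u w] pw br_skew[of p w]
        g_br[of p u w] by simp
    ultimately show ?thesis using line(2)[of u w] by (simp add: w gpw pw h_def algebra_simps)
  qed
  have sq: "br p (br p u) = 0" for u
    using ext_br_br[OF p, of u] two by (metis mult.commute scale_scale scale_zero_right)
  have "br p (br u (br p v)) = 0" for u v
  proof -
    have up: "br p (br u p) = 0" using sq[of u] br_skew[of u p] by simp
    have "br (br p u) h = 0"
      using ph by (simp add: form[of u] br_diff_left)
    then have "br p (br u h) = 0" using jacobi[of p u h] ph by simp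
    then show ?thesis using up by (simp add: form[of v] br_diff_right)
  qed
  then have "sandwich br p" using sq by (simp add: sandwich_def)
  then show False using ext_pure[OF p] by (simp add: pure_extremal_def)
qed

lemma Lm_eq_span:
  assumes "has_lines sm br" "hyperbolic x y"
  shows "Lm x y = span (Lm x y \<inter> {z. ext z})"
proof -
  have "\<exists>c\<in>Lm x y. ext c"
    using commuting_polarI[OF assms(2)] commuting_polar_all commuting_polar_no_lines assms(1)
    unfolding has_lines_def by blast
  then show ?thesis using Lm_span[OF assms(2)] by blast
qed

text \<open>Exchanging x and y only changes the sign of [x,y], so U stays the same; the case of L_1
  thus reduces to that of L_{-1}.\<close>

lemma grading_L1_eq: "grading_L1 br g x y = Lm y x"
proof -
  have "grading_U br g y x = grading_U br g x y"
    using br_skew[of y x] by (auto simp: grading_U_def)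
  then show ?thesis by (simp add: grading_L1_def grading_Lm1_def)
qed

end

theorem theorem3p8:
  fixes sm :: "'k::field \<Rightarrow> 'v::ab_group_add \<Rightarrow> 'v"
    and br :: "'v \<Rightarrow> 'v \<Rightarrow> 'v"
    and g :: "'v \<Rightarrow> 'v \<Rightarrow> 'k"
    and x y :: 'v
  assumes "card (UNIV :: 'k set) \<noteq> 2"
    and "simple_lie_algebra sm br"
    and "lie_generated sm br {z. pure_extremal sm br z} = UNIV"
    and "has_lines sm br"
    and "extremal_form sm br g"
    and "extremal sm br x" and "extremal sm br y" and "g x y = 1"
  shows "grading_Lm1 br g x y = module.span sm (grading_Lm1 br g x y \<inter> {z. extremal sm br z}) \<and>
         grading_L1 br g x y = module.span sm (grading_L1 br g x y \<inter> {z. extremal sm br z})"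
proof -
  interpret extremal_lie sm br g
    using assms(1-3,5) by unfold_locales
  have "hyperbolic x y" using assms(6-8) by (simp add: hyperbolic_def)
  then show ?thesis
    using Lm_eq_span[OF assms(4)] hyperbolic_sym grading_L1_eq by metis
qed

end
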